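(* Let $R$ be a ring, let $n$ be a positive integer, let $\sigma\colon R\to M_n(R)$ be a ring homomorphism, let $\delta\colon R\to R^n$ be a right $\sigma$-derivation and let $S$ be a $(\sigma,\delta)$-free skew extension of $R$ generated by $x_1,\dots,x_n$. Given an $R$-ring $A$ and elements $a_1,\dots,a_n$ of $A$ such that \[ ra_j=\sum_{i=1}^n a_i\sigma_{ij}(r)+\delta_j(r),\quad\text{for all } j=1,\dots,n \text{ and } r\in R, \] there exists a unique $R$-ring homomorphism $\varphi\colon S\to A$ such that $\varphi(x_i)=a_i$ for all $i=1,\dots,n$.
   Context: Rings are associative with identity element; ring homomorphisms preserve the identity; modules are unital. An $R$-ring is a ring $A$ together with a ring homomorphism $\lambda_A\colon R\to A$; it is an $R$-bimodule via $ra=\lambda_A(r)a$, $ar=a\lambda_A(r)$, and in expressions inside $A$ an element $r\in R$ stands for $\lambda_A(r)$. An $R$-ring homomorphism $\varphi\colon A\to B$ is a ring homomorphism with $\varphi\lambda_A=\lambda_B$. $R^n$ denotes row vectors with $n$ entries in $R$. For a ring homomorphism $\sigma\colon R\to M_n(R)$, a right $\sigma$-derivation is an additive map $\delta\colon R\to R^n$ with $\delta(rs)=\delta(r)\sigma(s)+r\delta(s)$ for all $r,s\in R$ (matrix product in the first term). Write $\sigma_{ij}(r)$ for the $(i,j)$-entry of $\sigma(r)$ and $\delta_j(r)$ for the $j$-th component of $\delta(r)$. A $(\sigma,\delta)$-free skew extension of $R$ generated by $X=\{x_1,\dots,x_n\}$ is an $R$-ring $S$ containing an $n$-element subset $X=\{x_1,\dots,x_n\}$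 such that (i) the submonoid $\langle X\rangle$ of the multiplicative monoid of $S$ generated by $X$ is free on $X$; (ii) $S$ is a free right $R$-module with basis $\langle X\rangle$; (iii) $rx_j=\sum_{i=1}^n x_i\sigma_{ij}(r)+\delta_j(r)$ for all $j=1,\dots,n$ and $r\in R$. *)

theory Defs
  imports "HOL-Algebra.RingHom"
begin

text \<open>An \<open>R\<close>-ring is a ring \<open>A\<close> together with its structure homomorphism \<open>l\<close>. All rings are
  \<open>HOL-Algebra\<close> rings, so the zero ring is allowed.\<close>

abbreviation is_R_ring ::
    "('r, 'm) ring_scheme \<Rightarrow> ('a, 'k) ring_scheme \<Rightarrow> ('r \<Rightarrow> 'a) \<Rightarrow> bool" where
  "is_R_ring R A l \<equiv> ring_hom_ring R A l"

definition R_ring_hom ::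
    "('r, 'm) ring_scheme \<Rightarrow> ('a, 'k) ring_scheme \<Rightarrow> ('r \<Rightarrow> 'a)
      \<Rightarrow> ('b, 'l) ring_scheme \<Rightarrow> ('r \<Rightarrow> 'b) \<Rightarrow> ('a \<Rightarrow> 'b) set" where
  "R_ring_hom R A lA B lB = {f \<in> ring_hom A B. \<forall>r\<in>carrier R. f (lA r) = lB r}"

text \<open>Matrices and row vectors are extensional functions on \<open>{1..n} \<times> {1..n}\<close> and \<open>{1..n}\<close>,
  so that two of them are equal iff their entries are.\<close>

definition matrix_ring :: "('r, 'm) ring_scheme \<Rightarrow> nat \<Rightarrow> (nat \<times> nat \<Rightarrow> 'r) ring" where
  "matrix_ring R n =
    \<lparr> carrier = {1..n} \<times> {1..n} \<rightarrow>\<^sub>E carrier R,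
      mult = (\<lambda>M N. \<lambda>(i, j)\<in>{1..n} \<times> {1..n}. \<Oplus>\<^bsub>R\<^esub>k\<in>{1..n}. M (i, k) \<otimes>\<^bsub>R\<^esub> N (k, j)),
      one = (\<lambda>(i, j)\<in>{1..n} \<times> {1..n}. if i = j then \<one>\<^bsub>R\<^esub> else \<zero>\<^bsub>R\<^esub>),
      zero = (\<lambda>(i, j)\<in>{1..n} \<times> {1..n}. \<zero>\<^bsub>R\<^esub>),
      add = (\<lambda>M N. \<lambda>(i, j)\<in>{1..n} \<times> {1..n}. M (i, j) \<oplus>\<^bsub>R\<^esub> N (i, j)) \<rparr>"

definition row_vectors :: "('r, 'm) ring_scheme \<Rightarrow> nat \<Rightarrow> (nat \<Rightarrow> 'r) set" where
  "row_vectors R n = {1..n} \<rightarrow>\<^sub>E carrier R"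

definition row_add :: "('r, 'm) ring_scheme \<Rightarrow> nat \<Rightarrow> (nat \<Rightarrow> 'r) \<Rightarrow> (nat \<Rightarrow> 'r) \<Rightarrow> nat \<Rightarrow> 'r" where
  "row_add R n u v = (\<lambda>j\<in>{1..n}. u j \<oplus>\<^bsub>R\<^esub> v j)"

definition row_scale :: "('r, 'm) ring_scheme \<Rightarrow> nat \<Rightarrow> 'r \<Rightarrow> (nat \<Rightarrow> 'r) \<Rightarrow> nat \<Rightarrow> 'r" where
  "row_scale R n r v = (\<lambda>j\<in>{1..n}. r \<otimes>\<^bsub>R\<^esub> v j)"

definition row_times_matrix ::
    "('r, 'm) ring_scheme \<Rightarrow> nat \<Rightarrow> (nat \<Rightarrow> 'r) \<Rightarrow> (nat \<times> nat \<Rightarrow> 'r) \<Rightarrow> nat \<Rightarrow> 'r" where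
  "row_times_matrix R n v M = (\<lambda>j\<in>{1..n}. \<Oplus>\<^bsub>R\<^esub>i\<in>{1..n}. v i \<otimes>\<^bsub>R\<^esub> M (i, j))"

definition right_derivation ::
    "('r, 'm) ring_scheme \<Rightarrow> nat \<Rightarrow> ('r \<Rightarrow> nat \<times> nat \<Rightarrow> 'r) \<Rightarrow> ('r \<Rightarrow> nat \<Rightarrow> 'r) \<Rightarrow> bool" where
  "right_derivation R n \<sigma> \<delta> \<longleftrightarrow>
    \<delta> \<in> carrier R \<rightarrow> row_vectors R n \<and>
    (\<forall>r\<in>carrier R. \<forall>s\<in>carrier R. \<delta> (r \<oplus>\<^bsub>R\<^esub> s) = row_add R n (\<delta> r) (\<delta> s)) \<and>
    (\<forall>r\<in>carrier R. \<forall>s\<in>carrier R.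
      \<delta> (r \<otimes>\<^bsub>R\<^esub> s) = row_add R n (row_times_matrix R n (\<delta> r) (\<sigma> s)) (row_scale R n r (\<delta> s)))"

definition generated_submonoid :: "('s, 'k) monoid_scheme \<Rightarrow> 's set \<Rightarrow> 's set" where
  "generated_submonoid M X = \<Inter>{H. submonoid H M \<and> X \<subseteq> H}"

text \<open>\<open>M\<close> is free on \<open>X\<close> if the canonical map from the free monoid of words over \<open>X\<close> to \<open>M\<close> is
  bijective.\<close>

definition free_monoid_on :: "('s, 'k) monoid_scheme \<Rightarrow> 's set \<Rightarrow> bool" where
  "free_monoid_on M X \<longleftrightarrow>
    bij_betw (\<lambda>ws. foldr (\<lambda>x y. x \<otimes>\<^bsub>M\<^esub> y) ws \<one>\<^bsub>M\<^esub>) (lists X) (carrier M)"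

text \<open>The right \<open>R\<close>-module structure of the \<open>R\<close>-ring \<open>S\<close> is \<open>s r = s \<otimes> l r\<close>.\<close>

definition right_module_basis ::
    "('r, 'm) ring_scheme \<Rightarrow> ('s, 'k) ring_scheme \<Rightarrow> ('r \<Rightarrow> 's) \<Rightarrow> 's set \<Rightarrow> bool" where
  "right_module_basis R S l B \<longleftrightarrow>
    B \<subseteq> carrier S \<and>
    (\<forall>s\<in>carrier S. \<exists>F c. finite F \<and> F \<subseteq> B \<and> c \<in> F \<rightarrow> carrier R \<and>
      s = (\<Oplus>\<^bsub>S\<^esub>b\<in>F. b \<otimes>\<^bsub>S\<^esub> l (c b))) \<and>
    (\<forall>F c. finite F \<and> F \<subseteq> B \<and> c \<in> F \<rightarrow> carrier R \<and>
      (\<Oplus>\<^bsub>S\<^esub>b\<in>F. b \<otimes>\<^bsub>S\<^esub> l (c b)) = \<zero>\<^bsub>S\<^esub> \<longrightarrow> (\<forall>b\<in>F. c b = \<zero>\<^bsub>R\<^esub>))"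

definition free_skew_extension ::
    "('r, 'm) ring_scheme \<Rightarrow> nat \<Rightarrow> ('r \<Rightarrow> nat \<times> nat \<Rightarrow> 'r) \<Rightarrow> ('r \<Rightarrow> nat \<Rightarrow> 'r)
      \<Rightarrow> ('s, 'k) ring_scheme \<Rightarrow> ('r \<Rightarrow> 's) \<Rightarrow> (nat \<Rightarrow> 's) \<Rightarrow> bool" where
  "free_skew_extension R n \<sigma> \<delta> S l x \<longleftrightarrow>
    is_R_ring R S l \<and>
    x \<in> {1..n} \<rightarrow> carrier S \<and> inj_on x {1..n} \<and>
    free_monoid_on (S\<lparr>carrier := generated_submonoid S (x ` {1..n})\<rparr>) (x ` {1..n}) \<and>
    right_module_basis R S l (generated_submonoid S (x ` {1..n})) \<and>
    (\<forall>j\<in>{1..n}. \<forall>r\<in>carrier R.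
      l r \<otimes>\<^bsub>S\<^esub> x j = (\<Oplus>\<^bsub>S\<^esub>i\<in>{1..n}. x i \<otimes>\<^bsub>S\<^esub> l (\<sigma> r (i, j))) \<oplus>\<^bsub>S\<^esub> l (\<delta> r j))"

end

theory Submission
  imports Defs
begin

text \<open>Since the words in the \<open>x\<^sub>i\<close> form a right \<open>R\<close>-basis of \<open>S\<close>, there is a unique right
  \<open>R\<close>-linear map \<open>\<phi>\<close> sending each word to the same word in the \<open>a\<^sub>i\<close>, and it satisfies
  \<open>\<phi> (x\<^sub>i s) = a\<^sub>i \<phi> s\<close>. Moving \<open>r\<close> past the first letter of a word by the commutation rule,
  an induction on words, for all \<open>r\<close> simultaneously, gives \<open>\<phi> (r s) = r \<phi> s\<close>. The elements \<open>s\<close> with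
  \<open>\<phi> (s t) = \<phi> s \<phi> t\<close> for all \<open>t\<close> form a subring containing
  the image of \<open>R\<close> and all \<open>x\<^sub>i\<close>, which therefore is all of \<open>S\<close>.\<close>

section \<open>Free monoids: induction and recursion along words\<close>

lemma free_monoid_induct [consumes 2, case_names one mult]:
  assumes "free_monoid_on M X" "b \<in> carrier M"
    and "P \<one>\<^bsub>M\<^esub>"
    and "\<And>x b. x \<in> X \<Longrightarrow> b \<in> carrier M \<Longrightarrow> P b \<Longrightarrow> P (x \<otimes>\<^bsub>M\<^esub> b)"
  shows "P b"
proof -
  let ?ev = "\<lambda>ws. foldr (\<lambda>x y. x \<otimes>\<^bsub>M\<^esub> y) ws \<one>\<^bsub>M\<^esub>"
  have im: "?ev ` lists X = carrier M"
    using assms(1) by (simp add: free_monoid_on_def bij_betw_def)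
  \<comment> \<open>Every element of the carrier is the value of a word, so induction on words
    suffices. Evaluation by \<open>foldr\<close> splits off the first letter, hence the step
    multiplies by a letter on the left.\<close>
  have "P (?ev ws)" if "ws \<in> lists X" for ws
    using that
  proof induction
    case (Cons w ws)
    have "?ev ws \<in> carrier M" using im Cons.hyps by blast
    then show ?case using assms(4) Cons by simp
  qed (simp add: assms(3))
  with im assms(2) show ?thesis by (metis imageE)
qed

lemma free_monoid_one_closed: "free_monoid_on M X \<Longrightarrow> \<one>\<^bsub>M\<^esub> \<in> carrier M"
  unfolding free_monoid_on_def by (drule bij_betwE, drule bspec[of _ _ "[]"]) auto

text \<open>Prepending the letter \<open>x\<close> to a word for \<open>b\<close> gives a word whose
  value is the product.\<close>

lemma free_monoid_mult_closed:
  assumes "free_monoid_on M X" "x \<in> X" "b \<in> carrier M"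
  shows "x \<otimes>\<^bsub>M\<^esub> b \<in> carrier M"
proof -
  let ?ev = "\<lambda>ws. foldr (\<lambda>x y. x \<otimes>\<^bsub>M\<^esub> y) ws \<one>\<^bsub>M\<^esub>"
  have im: "?ev ` lists X = carrier M"
    using assms(1) by (simp add: free_monoid_on_def bij_betw_def)
  with assms(3) obtain ws where ws: "ws \<in> lists X" "b = ?ev ws" by blast
  then have "x # ws \<in> lists X" using assms(2) by simp
  with im have "?ev (x # ws) \<in> carrier M" by blast
  with ws show ?thesis by simp
qed

text \<open>Injectivity of evaluation attaches exactly one word to each element, so folding
  \<open>h\<close> over that word is well defined. This is recursion on the first letter.\<close>

lemma free_monoid_rec:
  assumes "free_monoid_on M X"
  obtains \<psi> where "\<psi> \<one>\<^bsub>M\<^esub> = e"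
    and "\<And>x b. x \<in> X \<Longrightarrow> b \<in> carrier M \<Longrightarrow> \<psi> (x \<otimes>\<^bsub>M\<^esub> b) = h x (\<psi> b)"
proof -
  let ?ev = "\<lambda>ws. foldr (\<lambda>x y. x \<otimes>\<^bsub>M\<^esub> y) ws \<one>\<^bsub>M\<^esub>"
  have im: "?ev ` lists X = carrier M" and inj: "inj_on ?ev (lists X)"
    using assms by (simp_all add: free_monoid_on_def bij_betw_def)
  define \<psi> where "\<psi> b = foldr h (inv_into (lists X) ?ev b) e" for b
  have \<psi>: "\<psi> (?ev ws) = foldr h ws e" if "ws \<in> lists X" for ws
    unfolding \<psi>_def using inv_into_f_f[OF inj that] by simp
  show thesis
  proof
    show "\<psi> \<one>\<^bsub>M\<^esub> = e" using \<psi>[of "[]"] by simp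
    fix x b assume x: "x \<in> X" and "b \<in> carrier M"
    with im obtain ws where ws: "ws \<in> lists X" "b = ?ev ws" by blast
    then show "\<psi> (x \<otimes>\<^bsub>M\<^esub> b) = h x (\<psi> b)"
      using \<psi>[of ws] \<psi>[of "x # ws"] x by simp
  qed
qed

text \<open>The vectors \<open>v\<close> are separate from the index set so that one notion serves
  both rings: with \<open>v\<close> the identity it is a combination of basis elements in the
  source, with \<open>v\<close> a map on the basis it is the corresponding combination of their
  images.\<close>

definition lincomb ::
    "('s, 'k) ring_scheme \<Rightarrow> ('r \<Rightarrow> 's) \<Rightarrow> ('b \<Rightarrow> 's) \<Rightarrow> 'b set \<Rightarrow> ('b \<Rightarrow> 'r) \<Rightarrow> 's" where
  "lincomb S l v F c = (\<Oplus>\<^bsub>S\<^esub>b\<in>F. v b \<otimes>\<^bsub>S\<^esub> l (c b))"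

section \<open>Linear combinations over a basis and extension of maps from it\<close>

context ring_hom_ring
begin

lemma lincomb_closed:
  assumes "v \<in> F \<rightarrow> carrier S" "c \<in> F \<rightarrow> carrier R"
  shows "lincomb S h v F c \<in> carrier S"
  unfolding lincomb_def using assms by (intro S.finsum_closed) (auto simp: Pi_iff)

lemma lincomb_add:
  assumes "v \<in> F \<rightarrow> carrier S" "c \<in> F \<rightarrow> carrier R" "d \<in> F \<rightarrow> carrier R"
  shows "lincomb S h v F (\<lambda>b. c b \<oplus> d b) = lincomb S h v F c \<oplus>\<^bsub>S\<^esub> lincomb S h v F d"
proof -
  have "lincomb S h v F (\<lambda>b. c b \<oplus> d b)
      = (\<Oplus>\<^bsub>S\<^esub>b\<in>F. v b \<otimes>\<^bsub>S\<^esub> h (c b) \<oplus>\<^bsub>S\<^esub> v b \<otimes>\<^bsub>S\<^esub> h (d b))"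
    unfolding lincomb_def using assms
    by (intro S.add.finprod_cong') (auto simp: Pi_iff S.r_distr)
  also have "\<dots> = lincomb S h v F c \<oplus>\<^bsub>S\<^esub> lincomb S h v F d"
    unfolding lincomb_def using assms by (intro S.finsum_addf) (auto simp: Pi_iff)
  finally show ?thesis .
qed

text \<open>The added terms vanish because \<open>h\<close> sends zero to zero. This allows
  combinations with different supports to be compared on the union.\<close>

lemma lincomb_zero_extend:
  assumes "finite G" "F \<subseteq> G" "v \<in> G \<rightarrow> carrier S" "c \<in> F \<rightarrow> carrier R"
  shows "lincomb S h v F c = lincomb S h v G (\<lambda>b. if b \<in> F then c b else \<zero>)"
  unfolding lincomb_def using assms
  by (intro S.add.finprod_mono_neutral_cong_left) (auto simp: Pi_iff subset_iff)

lemma lincomb_zero_imp_zero: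
  assumes "right_module_basis R S h B" "finite F" "F \<subseteq> B" "c \<in> F \<rightarrow> carrier R"
    and "lincomb S h (\<lambda>b. b) F c = \<zero>\<^bsub>S\<^esub>" "b \<in> F"
  shows "c b = \<zero>"
  using assms unfolding right_module_basis_def lincomb_def by blast

text \<open>The coefficientwise differences form a relation with value zero, so linear independence
  makes each of them vanish.\<close>

lemma lincomb_inj:
  assumes basis: "right_module_basis R S h B" and F: "finite F" "F \<subseteq> B"
    and c: "c \<in> F \<rightarrow> carrier R" and d: "d \<in> F \<rightarrow> carrier R"
    and eq: "lincomb S h (\<lambda>b. b) F c = lincomb S h (\<lambda>b. b) F d" and b: "b \<in> F"
  shows "c b = d b"
proof -
  have B: "(\<lambda>b. b) \<in> F \<rightarrow> carrier S"
    using basis F unfolding right_module_basis_def by auto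
  define e where "e b = c b \<ominus> d b" for b
  have e: "e \<in> F \<rightarrow> carrier R" using c d by (auto simp: e_def Pi_iff)
  have ed: "e b \<oplus> d b = c b" if "b \<in> F" for b
  proof -
    have "c b \<in> carrier R" "d b \<in> carrier R" using that c d by auto
    then show ?thesis by (simp add: e_def R.minus_eq R.a_assoc R.l_neg)
  qed
  \<comment> \<open>Since \<open>c = e + d\<close> on \<open>F\<close>, additivity suffices:
    cancelling the combination of \<open>d\<close> shows that the one of \<open>e\<close> is
    zero.\<close>
  have "lincomb S h (\<lambda>b. b) F e \<oplus>\<^bsub>S\<^esub> lincomb S h (\<lambda>b. b) F d = lincomb S h (\<lambda>b. b) F c"
    unfolding lincomb_add[OF B e d, symmetric]
    unfolding lincomb_def using B c d ed
    by (intro S.add.finprod_cong') (auto simp: Pi_iff)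
  then have "lincomb S h (\<lambda>b. b) F e = \<zero>\<^bsub>S\<^esub>"
    using eq lincomb_closed[OF B e] lincomb_closed[OF B d] by simp
  from lincomb_zero_imp_zero[OF basis F e this b] ed[OF b] d b show ?thesis
    by (metis PiE R.l_zero)
qed

text \<open>A representation in the basis is a finite sum, so induction over its support builds
  every element from scaled basis elements. It serves to check additive identities on these
  alone.\<close>

lemma basis_induct [consumes 2, case_names zero scale add]:
  assumes "right_module_basis R S h B" "s \<in> carrier S"
    and zero: "P \<zero>\<^bsub>S\<^esub>"
    and scale: "\<And>b r. b \<in> B \<Longrightarrow> r \<in> carrier R \<Longrightarrow> P (b \<otimes>\<^bsub>S\<^esub> h r)"
    and add: "\<And>s t. s \<in> carrier S \<Longrightarrow> t \<in> carrier S \<Longrightarrow> P s \<Longrightarrow> P t \<Longrightarrow> P (s \<oplus>\<^bsub>S\<^esub> t)"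
  shows "P s"
proof -
  obtain F c where F: "finite F" "F \<subseteq> B" "c \<in> F \<rightarrow> carrier R"
    and s: "s = (\<Oplus>\<^bsub>S\<^esub>b\<in>F. b \<otimes>\<^bsub>S\<^esub> h (c b))"
    using assms(1,2) unfolding right_module_basis_def by meson
  have B: "B \<subseteq> carrier S" using assms(1) by (simp add: right_module_basis_def)
  from F have "P (\<Oplus>\<^bsub>S\<^esub>b\<in>F. b \<otimes>\<^bsub>S\<^esub> h (c b))"
  proof (induction F)
    case (insert b F)
    have "b \<in> carrier S" and cl: "(\<lambda>b. b \<otimes>\<^bsub>S\<^esub> h (c b)) \<in> F \<rightarrow> carrier S"
      and cb: "c b \<in> carrier R"
      using insert.prems B by (auto simp: Pi_iff subset_iff)
    then show ?case
      using insert by (simp add: add scale)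
  qed (simp add: zero)
  with s show ?thesis by simp
qed

text \<open>This is the universal property of a free module: replace each basis element in a
  representation by its image under \<open>\<psi>\<close>. Only additivity and the values on scaled
  basis elements are recorded; compatibility with all scalars follows from them in the main
  proof.\<close>

lemma right_module_basis_lift:
  assumes basis: "right_module_basis R S h B" and A: "ring_hom_ring R A k"
    and \<psi>: "\<psi> \<in> B \<rightarrow> carrier A"
  obtains \<phi> where "\<phi> \<in> carrier S \<rightarrow> carrier A"
    and "\<And>s t. s \<in> carrier S \<Longrightarrow> t \<in> carrier S \<Longrightarrow> \<phi> (s \<oplus>\<^bsub>S\<^esub> t) = \<phi> s \<oplus>\<^bsub>A\<^esub> \<phi> t"
    and "\<And>b r. b \<in> B \<Longrightarrow> r \<in> carrier R \<Longrightarrow> \<phi> (b \<otimes>\<^bsub>S\<^esub> h r) = \<psi> b \<otimes>\<^bsub>A\<^esub> k r"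
proof -
  interpret A: ring_hom_ring R A k by (fact A)
  let ?s = "lincomb S h (\<lambda>b. b)" and ?a = "lincomb A k \<psi>"
  let ?adm = "\<lambda>F c. finite F \<and> F \<subseteq> B \<and> c \<in> F \<rightarrow> carrier R"
  let ?ext = "\<lambda>F c b. if b \<in> F then c b else \<zero>"
  have B: "B \<subseteq> carrier S" using basis by (simp add: right_module_basis_def)
  have BS: "(\<lambda>b. b) \<in> F \<rightarrow> carrier S" if "F \<subseteq> B" for F using that B by auto
  have BA: "\<psi> \<in> F \<rightarrow> carrier A" if "F \<subseteq> B" for F using that \<psi> by auto
  have ext: "?ext F c \<in> G \<rightarrow> carrier R" if "?adm F c" for F G and c :: "'c \<Rightarrow> 'a"
    using that by auto
  have ext_s: "?s F c = ?s G (?ext F c)" and ext_a: "?a F c = ?a G (?ext F c)"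
    if "?adm F c" "finite G" "F \<subseteq> G" "G \<subseteq> B" for F G c
    using that lincomb_zero_extend[of G F "\<lambda>b. b" c] A.lincomb_zero_extend[of G F \<psi> c] BS BA
    by simp_all
  \<comment> \<open>Padded to the union of the supports, both coefficient families represent the
    same element and hence agree there, so their images agree as well.\<close>
  have unique: "?a F c = ?a G d" if "?adm F c" "?adm G d" "?s F c = ?s G d" for F G c d
  proof -
    let ?H = "F \<union> G"
    have H: "finite ?H" "F \<subseteq> ?H" "G \<subseteq> ?H" "?H \<subseteq> B" using that by auto
    have "?s ?H (?ext F c) = ?s ?H (?ext G d)"
      using that(3) ext_s[OF that(1) H(1,2,4)] ext_s[OF that(2) H(1,3,4)] by simp
    then have "?ext F c b = ?ext G d b" if "b \<in> ?H" for b
      using lincomb_inj[OF basis H(1,4) ext ext _ that] \<open>?adm F c\<close> \<open>?adm G d\<close> by blast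
    then have "?a ?H (?ext F c) = ?a ?H (?ext G d)"
      unfolding lincomb_def using BA[OF H(4)] ext[OF that(2), of ?H]
      by (intro A.S.add.finprod_cong') (auto simp: Pi_iff)
    then show ?thesis
      using ext_a[OF that(1) H(1,2,4)] ext_a[OF that(2) H(1,3,4)] by simp
  qed
  \<comment> \<open>By \<open>unique\<close> the value does not depend on the chosen representation.
    Outside \<open>carrier S\<close> there is none, and the value is arbitrary.\<close>
  define \<phi> where "\<phi> s = (SOME a. \<exists>F c. ?adm F c \<and> s = ?s F c \<and> a = ?a F c)" for s
  have \<phi>: "\<phi> (?s F c) = ?a F c" if "?adm F c" for F c
    unfolding \<phi>_def
  proof (rule someI2_ex)
    show "\<exists>a G d. ?adm G d \<and> ?s F c = ?s G d \<and> a = ?a G d" using that by blast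
  next
    fix a assume "\<exists>G d. ?adm G d \<and> ?s F c = ?s G d \<and> a = ?a G d"
    then show "a = ?a F c" using unique[OF that] by metis
  qed
  have repr: "\<exists>F c. ?adm F c \<and> s = ?s F c" if "s \<in> carrier S" for s
    using basis that unfolding right_module_basis_def lincomb_def by metis
  show thesis
  proof
    show "\<phi> \<in> carrier S \<rightarrow> carrier A"
    proof
      fix s assume "s \<in> carrier S"
      then obtain F c where F: "?adm F c" "s = ?s F c" using repr by blast
      then have "?a F c \<in> carrier A" by (intro A.lincomb_closed BA) auto
      then show "\<phi> s \<in> carrier A" using \<phi>[OF F(1)] F(2) by simp
    qed
  next
    fix s t assume "s \<in> carrier S" "t \<in> carrier S"
    then obtain F c G d where F: "?adm F c" "s = ?s F c" and G: "?adm G d" "t = ?s G d"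
      using repr by meson
    let ?H = "F \<union> G"
    let ?c = "?ext F c" and ?d = "?ext G d"
    have H: "finite ?H" "F \<subseteq> ?H" "G \<subseteq> ?H" "?H \<subseteq> B" using F G by auto
    have c: "?c \<in> ?H \<rightarrow> carrier R" and d: "?d \<in> ?H \<rightarrow> carrier R"
      using ext[OF F(1)] ext[OF G(1)] by blast+
    then have cd: "?adm ?H (\<lambda>b. ?c b \<oplus> ?d b)" using H by (auto simp: Pi_iff)
    have "s \<oplus>\<^bsub>S\<^esub> t = ?s ?H (\<lambda>b. ?c b \<oplus> ?d b)"
      unfolding lincomb_add[OF BS[OF H(4)] c d]
      using F(2) G(2) ext_s[OF F(1) H(1,2,4)] ext_s[OF G(1) H(1,3,4)] by simp
    then have "\<phi> (s \<oplus>\<^bsub>S\<^esub> t) = ?a ?H (\<lambda>b. ?c b \<oplus> ?d b)" using \<phi>[OF cd] by simp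
    also have "\<dots> = ?a F c \<oplus>\<^bsub>A\<^esub> ?a G d"
      unfolding A.lincomb_add[OF BA[OF H(4)] c d]
      using ext_a[OF F(1) H(1,2,4)] ext_a[OF G(1) H(1,3,4)] by simp
    finally show "\<phi> (s \<oplus>\<^bsub>S\<^esub> t) = \<phi> s \<oplus>\<^bsub>A\<^esub> \<phi> t" using F G \<phi> by simp
  next
    fix b r assume b: "b \<in> B" and r: "r \<in> carrier R"
    then have "b \<in> carrier S" "\<psi> b \<in> carrier A" using B \<psi> by auto
    then show "\<phi> (b \<otimes>\<^bsub>S\<^esub> h r) = \<psi> b \<otimes>\<^bsub>A\<^esub> k r"
      using \<phi>[of "{b}" "\<lambda>_. r"] b r by (simp add: lincomb_def)
  qed
qed

end

text \<open>Additivity forces zero to go to zero by cancellation, and induction on the index set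
  does the rest. It is what pushes \<open>\<phi>\<close> through the sum in the commutation rule
  before \<open>\<phi>\<close> is known to be multiplicative.\<close>

lemma additive_finsum:
  assumes "ring S" "ring A" "\<phi> \<in> carrier S \<rightarrow> carrier A"
    and add: "\<And>s t. s \<in> carrier S \<Longrightarrow> t \<in> carrier S \<Longrightarrow> \<phi> (s \<oplus>\<^bsub>S\<^esub> t) = \<phi> s \<oplus>\<^bsub>A\<^esub> \<phi> t"
    and "finite F" "f \<in> F \<rightarrow> carrier S"
  shows "\<phi> (\<Oplus>\<^bsub>S\<^esub>i\<in>F. f i) = (\<Oplus>\<^bsub>A\<^esub>i\<in>F. \<phi> (f i))"
proof -
  interpret S: ring S by (fact assms)
  interpret A: ring A by (fact assms)
  have "\<phi> \<zero>\<^bsub>S\<^esub> \<oplus>\<^bsub>A\<^esub> \<phi> \<zero>\<^bsub>S\<^esub> = \<phi> \<zero>\<^bsub>S\<^esub>" "\<phi> \<zero>\<^bsub>S\<^esub> \<in> carrier A"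
    using add[of "\<zero>\<^bsub>S\<^esub>" "\<zero>\<^bsub>S\<^esub>"] assms(3) by auto
  then have "\<phi> \<zero>\<^bsub>S\<^esub> = \<zero>\<^bsub>A\<^esub>" by simp
  with assms(5,6) show ?thesis
  proof (induction F)
    case (insert i F)
    then have "f i \<in> carrier S" "f \<in> F \<rightarrow> carrier S" by auto
    moreover from this have "\<phi> (f i) \<in> carrier A" "(\<lambda>i. \<phi> (f i)) \<in> F \<rightarrow> carrier A"
      using assms(3) by auto
    ultimately show ?case using insert by (simp add: add)
  qed simp
qed

theorem proposition1p2:
  fixes R :: "('r, 'm) ring_scheme"
    and S :: "('s, 'k) ring_scheme"
    and A :: "('a, 'l) ring_scheme"
    and n :: nat
    and \<sigma> :: "'r \<Rightarrow> nat \<times> nat \<Rightarrow> 'r"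
    and \<delta> :: "'r \<Rightarrow> nat \<Rightarrow> 'r"
    and lS :: "'r \<Rightarrow> 's" and x :: "nat \<Rightarrow> 's"
    and lA :: "'r \<Rightarrow> 'a" and a :: "nat \<Rightarrow> 'a"
  assumes "ring R"
    and "n \<ge> 1"
    and "\<sigma> \<in> ring_hom R (matrix_ring R n)"
    and "right_derivation R n \<sigma> \<delta>"
    and "free_skew_extension R n \<sigma> \<delta> S lS x"
    and "is_R_ring R A lA"
    and "a \<in> {1..n} \<rightarrow> carrier A"
    and "\<forall>j\<in>{1..n}. \<forall>r\<in>carrier R.
      lA r \<otimes>\<^bsub>A\<^esub> a j = (\<Oplus>\<^bsub>A\<^esub>i\<in>{1..n}. a i \<otimes>\<^bsub>A\<^esub> lA (\<sigma> r (i, j))) \<oplus>\<^bsub>A\<^esub> lA (\<delta> r j)"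
  shows "\<exists>!\<phi>. \<phi> \<in> extensional (carrier S) \<and> \<phi> \<in> R_ring_hom R S lS A lA \<and>
      (\<forall>i\<in>{1..n}. \<phi> (x i) = a i)"
proof -

  \<comment> \<open>The data of the extension and induction over its generators\<close>
  let ?B = "generated_submonoid S (x ` {1..n})"
  let ?M = "S\<lparr>carrier := ?B\<rparr>"
  \<comment> \<open>Keeps the index set in the form \<open>{1..n}\<close>, where simplification
    would otherwise turn 1 into \<open>Suc 0\<close>.\<close>
  note One_nat_def [simp del]
  interpret S: ring_hom_ring R S lS
    using assms(5) by (simp add: free_skew_extension_def)
  interpret A: ring_hom_ring R A lA by (fact assms(6))
  have x: "x i \<in> carrier S" if "i \<in> {1..n}" for i
    using assms(5) that by (auto simp: free_skew_extension_def)
  have inj: "inj_on x {1..n}" and free: "free_monoid_on ?M (x ` {1..n})"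
    and basis: "right_module_basis R S lS ?B"
    using assms(5) by (simp_all add: free_skew_extension_def)
  have commS: "lS r \<otimes>\<^bsub>S\<^esub> x j =
      (\<Oplus>\<^bsub>S\<^esub>i\<in>{1..n}. x i \<otimes>\<^bsub>S\<^esub> lS (\<sigma> r (i, j))) \<oplus>\<^bsub>S\<^esub> lS (\<delta> r j)"
    if "j \<in> {1..n}" "r \<in> carrier R" for j r
    using assms(5) that by (simp add: free_skew_extension_def)
  have a: "a i \<in> carrier A" if "i \<in> {1..n}" for i using assms(7) that by auto
  have \<sigma>: "\<sigma> r (i, j) \<in> carrier R" if "r \<in> carrier R" "i \<in> {1..n}" "j \<in> {1..n}" for r i j
  proof -
    have "\<sigma> r \<in> {1..n} \<times> {1..n} \<rightarrow>\<^sub>E carrier R"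
      using ring_hom_closed[OF assms(3) that(1)] by (simp add: matrix_ring_def)
    then show ?thesis using that by auto
  qed
  have \<delta>: "\<delta> r j \<in> carrier R" if "r \<in> carrier R" "j \<in> {1..n}" for r j
  proof -
    have "\<delta> r \<in> {1..n} \<rightarrow>\<^sub>E carrier R"
      using assms(4) that(1) by (auto simp: right_derivation_def row_vectors_def)
    then show ?thesis using that by auto
  qed
  have B: "b \<in> carrier S" if "b \<in> ?B" for b
    using basis that by (auto simp: right_module_basis_def)
  have oneB: "\<one>\<^bsub>S\<^esub> \<in> ?B" using free_monoid_one_closed[OF free] by simp
  have xB: "x i \<otimes>\<^bsub>S\<^esub> b \<in> ?B" if "i \<in> {1..n}" "b \<in> ?B" for i b
    using free_monoid_mult_closed[OF free, of "x i" b] that by simp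
  have word_induct: "P b"
    if "b \<in> ?B" "P \<one>\<^bsub>S\<^esub>"
      "\<And>i b. i \<in> {1..n} \<Longrightarrow> b \<in> ?B \<Longrightarrow> P b \<Longrightarrow> P (x i \<otimes>\<^bsub>S\<^esub> b)" for P b
  proof (rule free_monoid_induct[OF free, of b P])
    fix y c assume "y \<in> x ` {1..n}" "c \<in> carrier ?M" "P c"
    then show "P (y \<otimes>\<^bsub>?M\<^esub> c)" using that(3) by auto
  qed (simp_all add: that)
  \<comment> \<open>\<open>S\<close> is generated as a ring by the image of \<open>R\<close> and the
    \<open>x i\<close>: words are products of letters starting from one, and both zero and one are
    images of coefficients.\<close>
  have gen_induct: "P s"
    if "s \<in> carrier S" and coeff: "\<And>r. r \<in> carrier R \<Longrightarrow> P (lS r)"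
      and var: "\<And>i. i \<in> {1..n} \<Longrightarrow> P (x i)"
      and add: "\<And>s t. s \<in> carrier S \<Longrightarrow> t \<in> carrier S \<Longrightarrow> P s \<Longrightarrow> P t \<Longrightarrow> P (s \<oplus>\<^bsub>S\<^esub> t)"
      and mult: "\<And>s t. s \<in> carrier S \<Longrightarrow> t \<in> carrier S \<Longrightarrow> P s \<Longrightarrow> P t \<Longrightarrow> P (s \<otimes>\<^bsub>S\<^esub> t)"
    for P s
  proof -
    have "P b" if "b \<in> ?B" for b
      using that
    proof (rule word_induct)
      show "P \<one>\<^bsub>S\<^esub>" using coeff[of "\<one>\<^bsub>R\<^esub>"] by simp
    qed (simp add: mult var x B)
    with basis \<open>s \<in> carrier S\<close> show ?thesis
    proof (induction rule: S.basis_induct)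
      case zero
      show ?case using coeff[of "\<zero>\<^bsub>R\<^esub>"] by simp
    qed (simp_all add: add mult coeff B)
  qed

  \<comment> \<open>Construction of \<open>\<phi>\<close> and its compatibility with coefficients on
    the right and letters on the left\<close>
  obtain \<psi> where \<psi>_one: "\<psi> \<one>\<^bsub>S\<^esub> = \<one>\<^bsub>A\<^esub>"
    and \<psi>_x': "\<And>y b. y \<in> x ` {1..n} \<Longrightarrow> b \<in> ?B
      \<Longrightarrow> \<psi> (y \<otimes>\<^bsub>S\<^esub> b) = a (inv_into {1..n} x y) \<otimes>\<^bsub>A\<^esub> \<psi> b"
    using free_monoid_rec[OF free, of "\<one>\<^bsub>A\<^esub>" "\<lambda>y z. a (inv_into {1..n} x y) \<otimes>\<^bsub>A\<^esub> z"] by auto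
  \<comment> \<open>Since \<open>x\<close> is injective on the indices, a letter determines its
    index, and the recursion can be stated for indices.\<close>
  have \<psi>_x: "\<psi> (x i \<otimes>\<^bsub>S\<^esub> b) = a i \<otimes>\<^bsub>A\<^esub> \<psi> b" if "i \<in> {1..n}" "b \<in> ?B" for i b
    using \<psi>_x'[of "x i" b] that inj by simp
  have \<psi>: "\<psi> b \<in> carrier A" if "b \<in> ?B" for b
    using that by (rule word_induct) (simp_all add: \<psi>_one \<psi>_x a)
  obtain \<phi> where \<phi>: "\<phi> \<in> carrier S \<rightarrow> carrier A"
    and \<phi>_add: "\<And>s t. s \<in> carrier S \<Longrightarrow> t \<in> carrier S \<Longrightarrow> \<phi> (s \<oplus>\<^bsub>S\<^esub> t) = \<phi> s \<oplus>\<^bsub>A\<^esub> \<phi> t"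
    and \<phi>_scale: "\<And>b r. b \<in> ?B \<Longrightarrow> r \<in> carrier R \<Longrightarrow> \<phi> (b \<otimes>\<^bsub>S\<^esub> lS r) = \<psi> b \<otimes>\<^bsub>A\<^esub> lA r"
    using S.right_module_basis_lift[OF basis assms(6), of \<psi>] \<psi> by blast
  have \<phi>_closed: "\<phi> s \<in> carrier A" if "s \<in> carrier S" for s using \<phi> that by auto
  note \<phi>_sum = additive_finsum[OF S.S.ring_axioms A.S.ring_axioms \<phi> \<phi>_add]
  have \<phi>_zero: "\<phi> \<zero>\<^bsub>S\<^esub> = \<zero>\<^bsub>A\<^esub>" using \<phi>_sum[of "{}" undefined] by simp
  have \<phi>_l: "\<phi> (lS r) = lA r" if "r \<in> carrier R" for r
    using \<phi>_scale[OF oneB that] that by (simp add: \<psi>_one)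
  have \<phi>_word: "\<phi> b = \<psi> b" if "b \<in> ?B" for b
    using \<phi>_scale[OF that, of "\<one>\<^bsub>R\<^esub>"] that by (simp add: B \<psi>)
  \<comment> \<open>On a scaled word \<open>b t\<close> the extra factor \<open>r\<close> is
    absorbed into the coefficient, as \<open>(b t) r = b (t r)\<close>.\<close>
  have \<phi>_r: "\<phi> (s \<otimes>\<^bsub>S\<^esub> lS r) = \<phi> s \<otimes>\<^bsub>A\<^esub> lA r" if "s \<in> carrier S" "r \<in> carrier R" for s r
    using basis that(1)
  proof (induction rule: S.basis_induct)
    case (scale b t)
    have "\<phi> (b \<otimes>\<^bsub>S\<^esub> lS t \<otimes>\<^bsub>S\<^esub> lS r) = \<phi> (b \<otimes>\<^bsub>S\<^esub> lS (t \<otimes>\<^bsub>R\<^esub> r))"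
      using scale that(2) by (simp add: B S.S.m_assoc)
    also have "\<dots> = \<psi> b \<otimes>\<^bsub>A\<^esub> lA (t \<otimes>\<^bsub>R\<^esub> r)"
      using scale that(2) by (intro \<phi>_scale) auto
    also have "\<dots> = \<phi> (b \<otimes>\<^bsub>S\<^esub> lS t) \<otimes>\<^bsub>A\<^esub> lA r"
      using scale that(2) by (simp add: \<phi>_scale \<psi> A.S.m_assoc)
    finally show ?case .
  qed (simp_all add: that(2) \<phi>_zero \<phi>_add S.S.l_distr A.S.l_distr \<phi>_closed)
  \<comment> \<open>Left multiplication by a letter takes words to words, so on a scaled word the
    recursion for \<open>\<psi>\<close> applies.\<close>
  have \<phi>_x: "\<phi> (x i \<otimes>\<^bsub>S\<^esub> s) = a i \<otimes>\<^bsub>A\<^esub> \<phi> s" if i: "i \<in> {1..n}" and "s \<in> carrier S" for i s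
    using basis that(2)
  proof (induction rule: S.basis_induct)
    case (scale b r)
    have "\<phi> (x i \<otimes>\<^bsub>S\<^esub> (b \<otimes>\<^bsub>S\<^esub> lS r)) = \<phi> ((x i \<otimes>\<^bsub>S\<^esub> b) \<otimes>\<^bsub>S\<^esub> lS r)"
      using scale i by (simp add: x B S.S.m_assoc)
    then show ?case
      using scale i xB by (simp add: \<phi>_scale \<psi>_x \<psi> a A.S.m_assoc)
  qed (use i in \<open>simp_all add: x a \<phi>_zero \<phi>_add S.S.r_distr A.S.r_distr \<phi>_closed\<close>)

  \<comment> \<open>Compatibility with coefficients on the left\<close>
  have \<phi>_l_word: "\<forall>r\<in>carrier R. \<phi> (lS r \<otimes>\<^bsub>S\<^esub> b) = lA r \<otimes>\<^bsub>A\<^esub> \<phi> b" if "b \<in> ?B" for b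
    using that
  proof (rule word_induct)
    show "\<forall>r\<in>carrier R. \<phi> (lS r \<otimes>\<^bsub>S\<^esub> \<one>\<^bsub>S\<^esub>) = lA r \<otimes>\<^bsub>A\<^esub> \<phi> \<one>\<^bsub>S\<^esub>"
      by (simp add: \<phi>_l \<phi>_word[OF oneB] \<psi>_one)
  next
    \<comment> \<open>The hypothesis must cover all coefficients: moving \<open>r\<close> past
      \<open>x j\<close> leaves the various \<open>\<sigma> r (i, j)\<close> and
      \<open>\<delta> r j\<close> in front of \<open>b\<close>.\<close>
    fix j b assume j: "j \<in> {1..n}" and b: "b \<in> ?B"
      and IH: "\<forall>r\<in>carrier R. \<phi> (lS r \<otimes>\<^bsub>S\<^esub> b) = lA r \<otimes>\<^bsub>A\<^esub> \<phi> b"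
    show "\<forall>r\<in>carrier R. \<phi> (lS r \<otimes>\<^bsub>S\<^esub> (x j \<otimes>\<^bsub>S\<^esub> b)) = lA r \<otimes>\<^bsub>A\<^esub> \<phi> (x j \<otimes>\<^bsub>S\<^esub> b)"
    proof
      fix r assume r: "r \<in> carrier R"
      have bS: "b \<in> carrier S" and bA: "\<phi> b \<in> carrier A" using b B \<phi>_closed by auto
      have xs: "(\<lambda>i. x i \<otimes>\<^bsub>S\<^esub> lS (\<sigma> r (i, j))) \<in> {1..n} \<rightarrow> carrier S"
        and as: "(\<lambda>i. a i \<otimes>\<^bsub>A\<^esub> lA (\<sigma> r (i, j))) \<in> {1..n} \<rightarrow> carrier A"
        using r j by (simp_all add: Pi_iff x a \<sigma>)
      have xbs: "(\<lambda>i. x i \<otimes>\<^bsub>S\<^esub> (lS (\<sigma> r (i, j)) \<otimes>\<^bsub>S\<^esub> b)) \<in> {1..n} \<rightarrow> carrier S"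
        using r j by (simp add: Pi_iff x bS \<sigma>)
      have "lS r \<otimes>\<^bsub>S\<^esub> (x j \<otimes>\<^bsub>S\<^esub> b) = (lS r \<otimes>\<^bsub>S\<^esub> x j) \<otimes>\<^bsub>S\<^esub> b"
        using r j bS by (simp add: x S.S.m_assoc)
      also have "\<dots> = (\<Oplus>\<^bsub>S\<^esub>i\<in>{1..n}. x i \<otimes>\<^bsub>S\<^esub> lS (\<sigma> r (i, j))) \<otimes>\<^bsub>S\<^esub> b \<oplus>\<^bsub>S\<^esub> lS (\<delta> r j) \<otimes>\<^bsub>S\<^esub> b"
        using r j bS xs by (simp add: commS S.S.l_distr \<delta> S.S.finsum_closed)
      also have "(\<Oplus>\<^bsub>S\<^esub>i\<in>{1..n}. x i \<otimes>\<^bsub>S\<^esub> lS (\<sigma> r (i, j))) \<otimes>\<^bsub>S\<^esub> b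
          = (\<Oplus>\<^bsub>S\<^esub>i\<in>{1..n}. x i \<otimes>\<^bsub>S\<^esub> (lS (\<sigma> r (i, j)) \<otimes>\<^bsub>S\<^esub> b))"
        unfolding S.S.finsum_ldistr[OF finite_atLeastAtMost bS xs] using r j bS xbs
        by (intro S.S.add.finprod_cong') (auto simp: x \<sigma> S.S.m_assoc)
      finally have "\<phi> (lS r \<otimes>\<^bsub>S\<^esub> (x j \<otimes>\<^bsub>S\<^esub> b))
          = (\<Oplus>\<^bsub>A\<^esub>i\<in>{1..n}. \<phi> (x i \<otimes>\<^bsub>S\<^esub> (lS (\<sigma> r (i, j)) \<otimes>\<^bsub>S\<^esub> b))) \<oplus>\<^bsub>A\<^esub> \<phi> (lS (\<delta> r j) \<otimes>\<^bsub>S\<^esub> b)"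
        using r j bS xbs by (simp add: \<phi>_add \<phi>_sum \<delta> S.S.finsum_closed)
      also have "\<phi> (lS (\<delta> r j) \<otimes>\<^bsub>S\<^esub> b) = lA (\<delta> r j) \<otimes>\<^bsub>A\<^esub> \<phi> b"
        using IH r j by (simp add: \<delta>)
      \<comment> \<open>Each letter \<open>x i\<close> comes out as \<open>a i\<close>, and the
        hypothesis for the coefficient \<open>\<sigma> r (i, j)\<close> takes care of the
        rest.\<close>
      also have "(\<Oplus>\<^bsub>A\<^esub>i\<in>{1..n}. \<phi> (x i \<otimes>\<^bsub>S\<^esub> (lS (\<sigma> r (i, j)) \<otimes>\<^bsub>S\<^esub> b)))
          = (\<Oplus>\<^bsub>A\<^esub>i\<in>{1..n}. a i \<otimes>\<^bsub>A\<^esub> lA (\<sigma> r (i, j)) \<otimes>\<^bsub>A\<^esub> \<phi> b)"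
        using IH r j bS bA as
        by (intro A.S.add.finprod_cong') (auto simp: a \<sigma> \<phi>_x A.S.m_assoc)
      also have "\<dots> = (\<Oplus>\<^bsub>A\<^esub>i\<in>{1..n}. a i \<otimes>\<^bsub>A\<^esub> lA (\<sigma> r (i, j))) \<otimes>\<^bsub>A\<^esub> \<phi> b"
        using A.S.finsum_ldistr[OF finite_atLeastAtMost bA as] by simp
      also have "\<dots> \<oplus>\<^bsub>A\<^esub> lA (\<delta> r j) \<otimes>\<^bsub>A\<^esub> \<phi> b
          = ((\<Oplus>\<^bsub>A\<^esub>i\<in>{1..n}. a i \<otimes>\<^bsub>A\<^esub> lA (\<sigma> r (i, j))) \<oplus>\<^bsub>A\<^esub> lA (\<delta> r j)) \<otimes>\<^bsub>A\<^esub> \<phi> b"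
        using r j bA as by (simp add: A.S.l_distr \<delta> A.S.finsum_closed)
      \<comment> \<open>Here the relation imposed on the \<open>a j\<close> enters: it is the
        commutation rule of \<open>S\<close> transported to \<open>A\<close>, read from right to
        left.\<close>
      also have "\<dots> = (lA r \<otimes>\<^bsub>A\<^esub> a j) \<otimes>\<^bsub>A\<^esub> \<phi> b"
        using assms(8) r j by simp
      also have "\<dots> = lA r \<otimes>\<^bsub>A\<^esub> \<phi> (x j \<otimes>\<^bsub>S\<^esub> b)"
        using r j bS bA by (simp add: a \<phi>_x A.S.m_assoc)
      finally show "\<phi> (lS r \<otimes>\<^bsub>S\<^esub> (x j \<otimes>\<^bsub>S\<^esub> b)) = lA r \<otimes>\<^bsub>A\<^esub> \<phi> (x j \<otimes>\<^bsub>S\<^esub> b)" .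
    qed
  qed
  \<comment> \<open>The word case extends to scaled words by \<open>r (b t) = (r b) t\<close> and
    right linearity.\<close>
  have \<phi>_l_mult: "\<phi> (lS r \<otimes>\<^bsub>S\<^esub> s) = lA r \<otimes>\<^bsub>A\<^esub> \<phi> s" if r: "r \<in> carrier R" and "s \<in> carrier S" for r s
    using basis that(2)
  proof (induction rule: S.basis_induct)
    case (scale b t)
    have "\<phi> (lS r \<otimes>\<^bsub>S\<^esub> (b \<otimes>\<^bsub>S\<^esub> lS t)) = \<phi> ((lS r \<otimes>\<^bsub>S\<^esub> b) \<otimes>\<^bsub>S\<^esub> lS t)"
      using scale r by (simp add: B S.S.m_assoc)
    then show ?case
      using scale r \<phi>_l_word by (simp add: \<phi>_r B \<phi>_closed A.S.m_assoc)
  qed (use r in \<open>simp_all add: \<phi>_zero \<phi>_add S.S.r_distr A.S.r_distr \<phi>_closed\<close>)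

  \<comment> \<open>Multiplicativity, existence and uniqueness\<close>
  have \<phi>_var: "\<phi> (x i) = a i" if "i \<in> {1..n}" for i
    using \<phi>_x[OF that, of "\<one>\<^bsub>S\<^esub>"] that \<phi>_word[OF oneB] by (simp add: \<psi>_one x a)
  \<comment> \<open>With the second factor universally quantified, the property passes to products
    of first factors by associativity; for coefficients and letters it is already known.\<close>
  have \<phi>_mult: "\<forall>t\<in>carrier S. \<phi> (s \<otimes>\<^bsub>S\<^esub> t) = \<phi> s \<otimes>\<^bsub>A\<^esub> \<phi> t" if "s \<in> carrier S" for s
    using that
    by (rule gen_induct)
      (simp_all add: \<phi>_l \<phi>_l_mult \<phi>_var \<phi>_x \<phi>_add \<phi>_closed S.S.l_distr A.S.l_distr
        S.S.m_assoc A.S.m_assoc)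

  show ?thesis
  proof (rule ex1I)
    \<comment> \<open>Restriction fixes the arbitrary values outside \<open>carrier S\<close>, so
      that uniqueness can be an equality of functions.\<close>
    have "restrict \<phi> (carrier S) \<in> ring_hom S A"
      using \<phi>_mult \<phi>_word[OF oneB] by (auto intro!: ring_hom_memI simp: \<phi>_closed \<phi>_add \<psi>_one)
    then show "restrict \<phi> (carrier S) \<in> extensional (carrier S) \<and>
        restrict \<phi> (carrier S) \<in> R_ring_hom R S lS A lA \<and>
        (\<forall>i\<in>{1..n}. restrict \<phi> (carrier S) (x i) = a i)"
      by (auto simp: R_ring_hom_def \<phi>_l \<phi>_var x)
  next
    fix \<theta> assume \<theta>: "\<theta> \<in> extensional (carrier S) \<and> \<theta> \<in> R_ring_hom R S lS A lA \<and>
        (\<forall>i\<in>{1..n}. \<theta> (x i) = a i)"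
    then have hom: "\<theta> \<in> ring_hom S A" and coeff: "\<forall>r\<in>carrier R. \<theta> (lS r) = lA r"
      by (auto simp: R_ring_hom_def)
    \<comment> \<open>Both maps respect sums and products and agree on coefficients and letters, so
      induction over the generators applies.\<close>
    have "\<theta> s = \<phi> s" if "s \<in> carrier S" for s
      using that
      by (rule gen_induct)
        (use \<theta> coeff \<phi>_mult in \<open>simp_all add: \<phi>_l \<phi>_var \<phi>_add ring_hom_add[OF hom] ring_hom_mult[OF hom]\<close>)
    then show "\<theta> = restrict \<phi> (carrier S)"
      using \<theta> by (auto intro!: extensionalityI[of _ "carrier S"])
  qed
qed

end
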